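(* There is no separable Fréchet space which is of universal disposition for finite-dimensional Fréchet spaces.
   Context: A Fréchet space is a complete metrizable locally convex space; it is always considered with a fixed sequence of semi-norms $\{\|\cdot\|_i\}_{i\in\mathbb{N}}$ generating its topology. Writing $X\subseteq Y$ for Fréchet spaces means that $X$ is a linear subspace of $Y$ whose $i$-th semi-norm is the restriction of the $i$-th semi-norm of $Y$, for every $i$. A linear embedding $f\colon X\to Y$ between Fréchet spaces is an isometric embedding if $\|f(x)\|_i=\|x\|_i$ for all $i\in\mathbb{N}$ and $x\in X$. A Fréchet space $F$ is of universal disposition for finite-dimensional Fréchet spaces if for all finite-dimensional Fréchet spaces $X\subseteq Y$ and every isometric embedding $f_0\colon X\to F$ there exists an isometric embedding $f\colon Y\to F$ with $f\restriction X=f_0$. *)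

theory Defs
  imports "HOL-Analysis.Analysis" "HOL-Library.Function_Algebras"
begin

text \<open>
  The scalar field is a type \<open>'k\<close> of class \<open>real_normed_field\<close>, whose only instances, up to
  isometric isomorphism, are the real and the complex numbers (Ostrowski, Gelfand--Mazur);
  both cases are covered at once. A space with semi-norms consists of a subset of an ambient
  vector space and a sequence of functions of which only the values on that subset matter.
\<close>

record 'a seminormed =
  points :: "'a set"
  snorm :: "nat \<Rightarrow> 'a \<Rightarrow> real"

definition is_seminorm_on ::
  "('k::real_normed_field \<Rightarrow> 'a::ab_group_add \<Rightarrow> 'a) \<Rightarrow> 'a set \<Rightarrow> ('a \<Rightarrow> real) \<Rightarrow> bool"
  where "is_seminorm_on smul V p \<longleftrightarrow>
    (\<forall>x\<in>V. 0 \<le> p x) \<and>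
    (\<forall>c. \<forall>x\<in>V. p (smul c x) = norm c * p x) \<and>
    (\<forall>x\<in>V. \<forall>y\<in>V. p (x + y) \<le> p x + p y)"

text \<open>
  The open balls of the individual semi-norms form a subbase: the sequence of semi-norms is not
  required to be increasing.
\<close>

definition snorm_topology :: "'a::ab_group_add seminormed \<Rightarrow> 'a topology"
  where "snorm_topology F = topology_generated_by
    {{y \<in> points F. snorm F i (y - x) < r} | i x r. x \<in> points F \<and> 0 < r}"

definition snorm_Cauchy :: "'a::ab_group_add seminormed \<Rightarrow> (nat \<Rightarrow> 'a) \<Rightarrow> bool"
  where "snorm_Cauchy F \<sigma> \<longleftrightarrow>
    range \<sigma> \<subseteq> points F \<and>
    (\<forall>i. \<forall>e>0. \<exists>N. \<forall>m\<ge>N. \<forall>n\<ge>N. snorm F i (\<sigma> m - \<sigma> n) < e)"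

text \<open>
  A topology generated by semi-norms is a locally convex vector space topology. As it is
  required to be metrizable, completeness can be tested on sequences.
\<close>

definition frechet_space ::
  "('k::real_normed_field \<Rightarrow> 'a::ab_group_add \<Rightarrow> 'a) \<Rightarrow> 'a seminormed \<Rightarrow> bool"
  where "frechet_space smul F \<longleftrightarrow>
    vector_space smul \<and>
    module.subspace smul (points F) \<and>
    (\<forall>i. is_seminorm_on smul (points F) (snorm F i)) \<and>
    metrizable_space (snorm_topology F) \<and>
    (\<forall>\<sigma>. snorm_Cauchy F \<sigma> \<longrightarrow> (\<exists>l. limitin (snorm_topology F) \<sigma> l sequentially))"

definition finite_dim_frechet_space ::
  "('k::real_normed_field \<Rightarrow> 'a::ab_group_add \<Rightarrow> 'a) \<Rightarrow> 'a seminormed \<Rightarrow> bool"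
  where "finite_dim_frechet_space smul F \<longleftrightarrow>
    frechet_space smul F \<and> (\<exists>B. finite B \<and> module.span smul B = points F)"

text \<open>
  When both arguments are Frechet spaces over the same \<open>smul\<close>, inclusion of the sets of
  points already makes the first a linear subspace of the second.
\<close>

definition frechet_subspace :: "'a seminormed \<Rightarrow> 'a seminormed \<Rightarrow> bool"
  where "frechet_subspace X Y \<longleftrightarrow>
    points X \<subseteq> points Y \<and> (\<forall>i. \<forall>x\<in>points X. snorm X i x = snorm Y i x)"

definition isometric_embedding ::
  "('k \<Rightarrow> 'a::ab_group_add \<Rightarrow> 'a) \<Rightarrow> ('k \<Rightarrow> 'b::ab_group_add \<Rightarrow> 'b) \<Rightarrow>
    'a seminormed \<Rightarrow> 'b seminormed \<Rightarrow> ('a \<Rightarrow> 'b) \<Rightarrow> bool"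
  where "isometric_embedding smul1 smul2 X Y f \<longleftrightarrow>
    f ` points X \<subseteq> points Y \<and>
    (\<forall>x\<in>points X. \<forall>y\<in>points X. f (x + y) = f x + f y) \<and>
    (\<forall>c. \<forall>x\<in>points X. f (smul1 c x) = smul2 c (f x)) \<and>
    inj_on f (points X) \<and>
    (\<forall>i. \<forall>x\<in>points X. snorm Y i (f x) = snorm X i x)"

definition smul_seq :: "'k::real_normed_field \<Rightarrow> (nat \<Rightarrow> 'k) \<Rightarrow> nat \<Rightarrow> 'k"
  where "smul_seq c v = (\<lambda>n. c * v n)"

text \<open>
  HOL cannot quantify over types inside a formula, so the finite-dimensional spaces
  \<open>X \<subseteq> Y\<close> range over finite-dimensional subspaces of the space of all scalar sequences, with
  arbitrary semi-norms. This loses no generality: a finite-dimensional \<open>Y\<close> is linearly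
  isomorphic to such a subspace, and the semi-norms of \<open>X\<close> and \<open>Y\<close> can be carried along the
  isomorphism.
\<close>

definition universal_disposition ::
  "('k::real_normed_field \<Rightarrow> 'a::ab_group_add \<Rightarrow> 'a) \<Rightarrow> 'a seminormed \<Rightarrow> bool"
  where "universal_disposition smul F \<longleftrightarrow>
    (\<forall>(X :: (nat \<Rightarrow> 'k) seminormed) Y f0.
      finite_dim_frechet_space smul_seq X \<and> finite_dim_frechet_space smul_seq Y \<and>
      frechet_subspace X Y \<and> isometric_embedding smul_seq smul X F f0 \<longrightarrow>
      (\<exists>f. isometric_embedding smul_seq smul Y F f \<and> (\<forall>x\<in>points X. f x = f0 x)))"

end

theory Submission
  imports Defs "HOL-Computational_Algebra.Fundamental_Theorem_Algebra"
begin

text \<open>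
  A separable Frechet space \<open>F\<close> of universal disposition would contain uncountably many points
  at mutual distance at least \<open>1\<close> in one of its semi-norms. They arise from the many ways in which
  a Euclidean plane can be enlarged by one dimension.

  Let \<open>X\<close> be the plane \<open>'k\<^sup>2\<close> with all semi-norms equal to the Euclidean norm (\<open>euclid2\<close>), and for
  every real \<open>t\<close> let \<open>x\<^sub>t\<close> be the unit vector \<open>(cos t, sin t)\<close> and
  \<open>\<phi>\<^sub>t (z) = cos t z\<^sub>0 + sin t z\<^sub>1\<close>. Add a vector \<open>e\<close> and extend the norm by
  \<open>N\<^sub>t (z + b e) = max \<bar>z\<bar> (\<bar>\<phi>\<^sub>t z\<bar> + \<bar>b\<bar>)\<close> (\<open>tilted\<close>); this does not alter the norm of \<open>X\<close>
  because \<open>\<bar>\<phi>\<^sub>t z\<bar> \<le> \<bar>z\<bar>\<close>. Now \<open>N\<^sub>s (r x\<^sub>s + e) = r + 1\<close>, whereas for \<open>0 < \<bar>s - t\<bar> \<le> 1\<close> one has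
  \<open>\<bar>\<phi>\<^sub>t x\<^sub>s\<bar> = \<bar>cos (t - s)\<bar> < 1\<close> and therefore \<open>N\<^sub>t (r x\<^sub>s + e) = r\<close> as soon as \<open>r\<close> is large
  (\<open>tilted_direction_apex\<close>). The zero space embeds into \<open>F\<close>, hence so does \<open>X\<close>, hence the
  embedding of \<open>X\<close> extends to every \<open>(X + 'k e, N\<^sub>t)\<close>. If \<open>y\<^sub>t\<close> is the image of \<open>e\<close> under the
  extension for \<open>t\<close>, and \<open>g\<close> the embedding of \<open>X\<close>, then the points \<open>g (r x\<^sub>s) + y\<^sub>s\<close> and
  \<open>g (r x\<^sub>s) + y\<^sub>t\<close> have norms \<open>r + 1\<close> and \<open>r\<close>, so the distance of \<open>y\<^sub>s\<close> and \<open>y\<^sub>t\<close> is at least \<open>1\<close>.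
  Letting \<open>t\<close> range over \<open>[0, 1]\<close> contradicts separability (\<open>separated_family_countable\<close>).

  The other ingredient is that these finite-dimensional spaces are complete, which holds only
  because the scalar field is (\<open>real_normed_field_Cauchy_convergent\<close>). This comes out of the
  theorem of Ostrowski and of Gelfand and Mazur: every element of a real normed field is a
  root of a monic real polynomial of degree two (\<open>real_normed_field_quadratic\<close>), so the field is the
  real line or a copy of the complex plane.
\<close>

section \<open>Completeness of real normed fields\<close>

lemma poly_map_of_real_mult:
  fixes x :: "'k::{real_algebra_1, comm_ring_1}"
  shows "poly (map_poly of_real (p * q)) x
    = poly (map_poly of_real p) x * poly (map_poly of_real q) x"
proof -
  have "map_poly of_real (p * q) = map_poly of_real p * (map_poly of_real q :: 'k poly)"
    by (intro poly_eqI) (simp add: coeff_map_poly coeff_mult)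
  then show ?thesis by simp
qed

lemma poly_map_of_real_add:
  fixes x :: "'k::{real_algebra_1, comm_ring_1}"
  shows "poly (map_poly of_real (p + q)) x
    = poly (map_poly of_real p) x + poly (map_poly of_real q) x"
proof -
  have "map_poly of_real (p + q) = map_poly of_real p + (map_poly of_real q :: 'k poly)"
    by (intro poly_eqI) (simp add: coeff_map_poly)
  then show ?thesis by simp
qed

lemma poly_map_of_real_power:
  fixes x :: "'k::{real_algebra_1, comm_ring_1}"
  shows "poly (map_poly of_real (p ^ n)) x = poly (map_poly of_real p) x ^ n"
  by (induction n) (simp_all add: poly_map_of_real_mult)

text \<open>
  A real root of \<open>p\<close> gives a linear factor. A non-real root \<open>z\<close> is a root of a real quadratic
  polynomial, and dividing \<open>p\<close> by it leaves a remainder of degree at most one that vanishes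
  at \<open>z\<close>; as \<open>1\<close> and \<open>z\<close> are linearly independent over the reals, the remainder is zero.
\<close>
lemma real_poly_monic_factor:
  fixes p :: "real poly"
  assumes "degree p > 0"
  obtains g where "g dvd p" "lead_coeff g = 1" "degree g = 1 \<or> degree g = 2"
proof -
  define P :: "complex poly" where "P = map_poly of_real p"
  have "degree P = degree p"
    unfolding P_def by (rule degree_map_poly) simp
  then have "\<not> constant (poly P)"
    using assms constant_degree by force
  then obtain z where z: "poly P z = 0"
    using fundamental_theorem_of_algebra by blast
  show ?thesis
  proof (cases "Im z = 0")
    case True
    then have "z = of_real (Re z)"
      by (simp add: complex_eq_iff)
    moreover have "poly P (of_real (Re z)) = of_real (poly p (Re z))"
      unfolding P_def by (induction p) (auto simp: map_poly_pCons)
    ultimately have "poly p (Re z) = 0"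
      using z by (metis of_real_eq_0_iff)
    then have "[:- Re z, 1:] dvd p"
      by (simp add: poly_eq_0_iff_dvd)
    then show ?thesis
      using that by simp
  next
    case False
    define g where "g = [:(Re z)\<^sup>2 + (Im z)\<^sup>2, - 2 * Re z, 1:]"
    have gz: "poly (map_poly of_real g) z = 0"
      by (simp add: g_def map_poly_pCons complex_eq_iff algebra_simps power2_eq_square)
    define r where "r = p mod g"
    have deg: "degree r < 2"
      using degree_mod_less'[of g p] unfolding r_def g_def by (cases "p mod g = 0") (auto simp: g_def)
    have "P = map_poly of_real (g * (p div g) + r)"
      by (simp add: P_def r_def)
    then have "poly (map_poly of_real r) z = 0"
      using z gz by (simp only: poly_map_of_real_add poly_map_of_real_mult) simp
    moreover have r: "r = [:coeff r 0, coeff r 1:]"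
    proof (rule poly_eqI)
      fix n show "coeff r n = coeff [:coeff r 0, coeff r 1:] n"
        using deg by (cases n; cases "n - 1") (auto intro: coeff_eq_0)
    qed
    ultimately have "of_real (coeff r 0) + z * of_real (coeff r 1) = 0"
      by (metis (no_types, lifting) map_poly_0 map_poly_pCons of_real_0 poly_0 poly_pCons mult_zero_right add_0_right)
    then have "coeff r 1 = 0" "coeff r 0 = 0"
      using False by (auto simp: complex_eq_iff)
    then have "r = 0" using r by simp
    then have "g dvd p" by (simp add: r_def dvd_eq_mod_eq_0)
    then show ?thesis
      using that[of g] by (simp add: g_def)
  qed
qed

text \<open>
  The norm is multiplicative, so a lower bound on the values at \<open>x\<close> of monic quadratic
  polynomials propagates to all monic polynomials through their factorisation. Squaring the norm
  lets the linear factors, whose squares are monic quadratics, take part on equal terms.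
\<close>
lemma norm_monic_real_poly_ge:
  fixes x :: "'k::real_normed_field" and p :: "real poly"
  assumes m: "0 \<le> m" "\<And>a b. m \<le> norm (x\<^sup>2 + of_real a * x + of_real b)"
    and "lead_coeff p = 1"
  shows "m ^ degree p \<le> (norm (poly (map_poly of_real p) x))\<^sup>2"
  using \<open>lead_coeff p = 1\<close>
proof (induction "degree p" arbitrary: p rule: less_induct)
  case less
  show ?case
  proof (cases "degree p = 0")
    case True
    with less.prems have "p = 1"
      by (metis degree_0_id lead_coeff_pCons(2) pCons_one degree_eq_zeroE)
    then show ?thesis by simp
  next
    case False
    then obtain g where g: "g dvd p" "lead_coeff g = 1" "degree g = 1 \<or> degree g = 2"
      using real_poly_monic_factor by blast
    then obtain q where pq: "p = g * q" by blast
    have q1: "lead_coeff q = 1"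
      using less.prems g(2) by (simp add: pq lead_coeff_mult)
    have "q \<noteq> 0" "g \<noteq> 0" using q1 g(2) by auto
    then have deg: "degree p = degree g + degree q"
      by (simp add: pq degree_mult_eq)
    have IH: "m ^ degree q \<le> (norm (poly (map_poly of_real q) x))\<^sup>2"
      using less.hyps[of q] q1 deg g(3) by auto
    have "m ^ degree g \<le> (norm (poly (map_poly of_real g) x))\<^sup>2"
      using g(3)
    proof
      assume d: "degree g = 1"
      have ge: "g = [:coeff g 0, 1:]"
      proof (rule poly_eqI)
        fix n show "coeff g n = coeff [:coeff g 0, 1:] n"
          using d g(2) by (cases n; cases "n - 1") (auto intro: coeff_eq_0)
      qed
      define c where "c = coeff g 0"
      have "poly (map_poly of_real g) x = of_real c + x"
        by (subst ge) (simp add: map_poly_pCons c_def)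
      moreover have "(of_real c + x)\<^sup>2 = x\<^sup>2 + of_real (2 * c) * x + of_real (c\<^sup>2)"
        by (simp add: power2_sum algebra_simps)
      ultimately show ?thesis
        using m(2)[of "2 * c" "c\<^sup>2"] d by (simp flip: norm_power)
    next
      assume d: "degree g = 2"
      have ge: "g = [:coeff g 0, coeff g 1, 1:]"
      proof (rule poly_eqI)
        fix n :: nat
        consider "n = 0" | "n = 1" | "n = 2" | "n > 2" by linarith
        then show "coeff g n = coeff [:coeff g 0, coeff g 1, 1:] n"
          using d g(2) by cases (auto simp: coeff_eq_0 numeral_2_eq_2 coeff_pCons split: nat.splits)
      qed
      have "poly (map_poly of_real g) x = x\<^sup>2 + of_real (coeff g 1) * x + of_real (coeff g 0)"
        by (subst ge) (simp add: map_poly_pCons algebra_simps power2_eq_square)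
      then show ?thesis
        using m d by (simp add: power_mono)
    qed
    then have "m ^ degree g * m ^ degree q
        \<le> (norm (poly (map_poly of_real g) x))\<^sup>2 * (norm (poly (map_poly of_real q) x))\<^sup>2"
      using IH m(1) by (intro mult_mono) auto
    then show ?thesis
      unfolding deg power_add unfolding pq poly_map_of_real_mult norm_mult power_mult_distrib .
  qed
qed

text \<open>
  A non-real \<open>x\<close> has positive distance \<open>c\<close> from the real line. Hence \<open>\<bar>a x + b\<bar>\<close> controls
  \<open>\<bar>a\<bar>\<close> and \<open>\<bar>b\<bar>\<close>, and coefficients outside of a compact rectangle cannot do better than
  \<open>a = b = 0\<close>.
\<close>
lemma real_normed_field_quadratic_min:
  fixes x :: "'k::real_normed_field"
  assumes nr: "\<And>r. x \<noteq> of_real r"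
  obtains a0 b0 where "\<And>a b. norm (x\<^sup>2 + of_real a0 * x + of_real b0)
      \<le> norm (x\<^sup>2 + of_real a * x + of_real b)"
proof -
  obtain c where c: "c > 0" "\<And>r. c \<le> norm (x - of_real r)"
  proof -
    let ?K = "{- 2 * norm x..2 * norm x}"
    have "continuous_on ?K (\<lambda>r. norm (x - of_real r))"
      by (intro continuous_intros)
    then obtain r0 where r0: "\<And>r. r \<in> ?K \<Longrightarrow> norm (x - of_real r0) \<le> norm (x - of_real r)"
      using continuous_attains_inf[of ?K "\<lambda>r. norm (x - of_real r)"] by force
    have "norm (x - of_real r0) \<le> norm (x - of_real r)" if "r \<notin> ?K" for r
    proof -
      have "norm (x - of_real r) \<ge> \<bar>r\<bar> - norm x"
        using norm_triangle_ineq2[of "of_real r" x] by (simp add: norm_minus_commute)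
      moreover have "\<bar>r\<bar> > 2 * norm x" using that by auto
      moreover have "norm (x - of_real r0) \<le> norm x" using r0[of 0] by simp
      ultimately show ?thesis by linarith
    qed
    then show ?thesis
      using that[of "norm (x - of_real r0)"] r0 nr[of r0] by (metis right_minus_eq zero_less_norm_iff)
  qed
  define f where "f = (\<lambda>u. norm (x\<^sup>2 + of_real (fst u) * x + of_real (snd u)))"
  define A where "A = 2 * (norm x)\<^sup>2 / c"
  define B where "B = A * norm x + 2 * (norm x)\<^sup>2"
  have A0: "0 \<le> A" using c(1) by (simp add: A_def)
  have B0: "0 \<le> B" using A0 by (simp add: B_def)
  let ?K = "{-A..A} \<times> {-B..B}"
  have "compact ?K" by (intro compact_Times) auto
  moreover have "(0, 0) \<in> ?K" using A0 B0 by auto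
  moreover have "continuous_on ?K f"
    unfolding f_def by (intro continuous_intros)
  ultimately obtain u0 where u0: "\<And>u. u \<in> ?K \<Longrightarrow> f u0 \<le> f u"
    using continuous_attains_inf[of ?K f] by blast
  have f0: "f u0 \<le> (norm x)\<^sup>2"
    using u0[of "(0, 0)"] A0 B0 by (simp add: f_def norm_power)
  have "f u0 \<le> f (a, b)" for a b
  proof (rule ccontr)
    assume not: "\<not> ?thesis"
    then have lt: "f (a, b) < (norm x)\<^sup>2" using f0 by simp
    have "norm (of_real a * x + of_real b) \<le> f (a, b) + (norm x)\<^sup>2"
      using norm_triangle_ineq4[of "x\<^sup>2 + of_real a * x + of_real b" "x\<^sup>2"]
      by (simp add: f_def norm_power algebra_simps)
    then have lin: "norm (of_real a * x + of_real b) \<le> 2 * (norm x)\<^sup>2"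
      using lt by simp
    have "\<bar>a\<bar> * c \<le> norm (of_real a * x + of_real b)"
    proof (cases "a = 0")
      case False
      have "of_real a * x + of_real b = of_real a * (x - of_real (- b / a))"
        using False by (simp add: field_simps)
      then have "norm (of_real a * x + of_real b) = \<bar>a\<bar> * norm (x - of_real (- b / a))"
        by (simp only: norm_mult norm_of_real)
      then show ?thesis
        using c(2)[of "- b / a"] by (simp only: mult_left_mono abs_ge_zero)
    qed simp
    then have a: "\<bar>a\<bar> \<le> A"
      using lin c(1) by (simp add: A_def field_simps)
    have "\<bar>b\<bar> \<le> norm (of_real a * x + of_real b) + \<bar>a\<bar> * norm x"
      using norm_triangle_ineq4[of "of_real a * x + of_real b" "of_real a * x"]
      by (simp add: norm_mult)
    also have "\<dots> \<le> 2 * (norm x)\<^sup>2 + A * norm x"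
      using lin a by (intro add_mono mult_right_mono) auto
    finally have "\<bar>b\<bar> \<le> B" by (simp add: B_def)
    then have "(a, b) \<in> ?K" using a by auto
    then show False using u0 not by blast
  qed
  then show ?thesis
    using that[of "fst u0" "snd u0"] by (simp add: f_def)
qed

text \<open>
  Suppose that the minimum \<open>m\<close> of the values of monic quadratics at \<open>x\<close> is positive, and let
  \<open>h\<close> be a quadratic that attains it. With \<open>e = - m / 2\<close>, the polynomial
  \<open>h\<^bsup>n+1\<^esup> - e\<^bsup>n+1\<^esup>\<close> is the product of \<open>h - e\<close> and a monic \<open>Q\<close> of degree \<open>2 n\<close>, whose value
  has norm at least \<open>m\<^sup>n\<close>. So \<open>\<bar>h(x) - e\<bar> \<le> (m\<^bsup>n+1\<^esup> + (m/2)\<^bsup>n+1\<^esup>) / m\<^sup>n\<close>, and letting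
  \<open>n\<close> grow shows that \<open>h + m / 2\<close> attains the minimum again. Iterating, the constant
  coefficient grows without bound while the norm stays equal to \<open>m\<close>, which is absurd.
\<close>
lemma real_normed_field_quadratic:
  fixes x :: "'k::real_normed_field"
  shows "\<exists>a b. x\<^sup>2 + of_real a * x + of_real b = 0"
proof (cases "\<exists>r. x = of_real r")
  case True
  then obtain r where "x = of_real r" by blast
  then have "x\<^sup>2 + of_real 0 * x + of_real (- r\<^sup>2) = 0" by simp
  then show ?thesis by blast
next
  case False
  then obtain a b where min: "\<And>a' b'. norm (x\<^sup>2 + of_real a * x + of_real b)
      \<le> norm (x\<^sup>2 + of_real a' * x + of_real b')"
    using real_normed_field_quadratic_min[of x] by blast
  define m where "m = norm (x\<^sup>2 + of_real a * x + of_real b)"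
  have "m = 0"
  proof (rule ccontr)
    assume "m \<noteq> 0"
    then have m: "m > 0" by (simp add: m_def)
    have le: "m \<le> norm (x\<^sup>2 + of_real a' * x + of_real b')" for a' b'
      using min by (simp add: m_def)
    define h where "h s = [:s, a, 1:]" for s :: real
    define H where "H s = x\<^sup>2 + of_real a * x + of_real s" for s
    have evh: "poly (map_poly of_real (h s)) x = H s" for s
      by (simp add: h_def H_def map_poly_pCons algebra_simps power2_eq_square)
    have step: "norm (H (s + m / 2)) = m" if s: "norm (H s) = m" for s
    proof (rule antisym)
      show "m \<le> norm (H (s + m / 2))" using le unfolding H_def by blast
      have bound: "norm (H (s + m / 2)) \<le> m + m * (1 / 2) ^ Suc n" for n
      proof -
        define e where "e = [:- (m / 2):]"
        define Q where "Q = (\<Sum>i<Suc n. h s ^ i * e ^ (n - i))"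
        \<comment> \<open>The terms of \<open>Q\<close> below the last one have degree less than \<open>2 * n\<close>, so the top
          coefficients of \<open>Q\<close> are those of \<open>h s ^ n\<close>.\<close>
        have deg_term: "degree (h s ^ i * e ^ (n - i)) \<le> 2 * i" for i
        proof -
          have "degree (h s ^ i * e ^ (n - i)) \<le> degree (h s ^ i) + degree (e ^ (n - i))"
            by (rule degree_mult_le)
          also have "\<dots> \<le> 2 * i + 0"
            by (intro add_mono order_trans[OF degree_power_le]) (auto simp: h_def e_def)
          finally show ?thesis by simp
        qed
        have hn: "degree (h s ^ n) = 2 * n" "lead_coeff (h s ^ n) = 1"
          unfolding lead_coeff_power by (simp_all add: degree_power_eq h_def)
        have low: "coeff (\<Sum>i<n. h s ^ i * e ^ (n - i)) k = 0" if "k \<ge> 2 * n" for k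
          unfolding coeff_sum
        proof (intro sum.neutral ballI coeff_eq_0)
          fix i assume "i \<in> {..<n}"
          then show "degree (h s ^ i * e ^ (n - i)) < k"
            using deg_term[of i] that by (simp del: power_Suc)
        qed
        have Qc: "coeff Q k = coeff (h s ^ n) k" if "k \<ge> 2 * n" for k
          using low[OF that] by (simp add: Q_def)
        have degQ: "degree Q = 2 * n"
        proof (rule antisym)
          show "degree Q \<le> 2 * n"
            by (rule degree_le) (use Qc hn(1) in \<open>auto intro: coeff_eq_0\<close>)
          show "2 * n \<le> degree Q"
            by (rule le_degree) (use Qc[of "2 * n"] hn in auto)
        qed
        have leadQ: "lead_coeff Q = 1"
          using Qc[of "2 * n"] hn degQ by simp
        have "(m ^ n)\<^sup>2 \<le> (norm (poly (map_poly of_real Q) x))\<^sup>2"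
          using norm_monic_real_poly_ge[OF less_imp_le[OF m] le leadQ] degQ
          by (simp add: power_mult[symmetric] mult.commute)
        then have Qge: "m ^ n \<le> norm (poly (map_poly of_real Q) x)"
          by (rule power2_le_imp_le) simp
        have hs: "h s - e = h (s + m / 2)" by (simp add: h_def e_def)
        have "h s ^ Suc n - e ^ Suc n = h (s + m / 2) * Q"
          unfolding Q_def hs[symmetric] by (subst power_diff_sumr2) (simp add: mult.commute)
        then have "h (s + m / 2) * Q + e ^ Suc n = h s ^ Suc n" by (simp add: algebra_simps)
        then have "H (s + m / 2) * poly (map_poly of_real Q) x
            + poly (map_poly of_real e) x ^ Suc n = H s ^ Suc n"
          by (metis poly_map_of_real_add poly_map_of_real_mult poly_map_of_real_power evh)
        moreover have "poly (map_poly of_real e) x = of_real (- (m / 2))"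
          by (simp add: e_def map_poly_pCons)
        ultimately have eq: "H (s + m / 2) * poly (map_poly of_real Q) x
            = H s ^ Suc n - of_real (- (m / 2)) ^ Suc n"
          by (metis add_diff_cancel_right')
        have "norm (H (s + m / 2)) * m ^ n \<le> norm (H (s + m / 2) * poly (map_poly of_real Q) x)"
          using Qge by (simp add: norm_mult mult_left_mono)
        also have "\<dots> \<le> m ^ Suc n + (m / 2) ^ Suc n"
          unfolding eq using norm_triangle_ineq4[of "H s ^ Suc n" "of_real (- (m / 2)) ^ Suc n"] m s
          by (simp only: norm_power norm_of_real) simp
        also have "\<dots> = (m + m * (1 / 2) ^ Suc n) * m ^ n"
          by (simp add: power_divide field_simps)
        finally show ?thesis using m by simp
      qed
      have "(\<lambda>n. m + m * (1 / 2) ^ Suc n) \<longlonglongrightarrow> m + m * 0"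
        by (intro tendsto_intros LIMSEQ_Suc LIMSEQ_power_zero) simp
      then show "norm (H (s + m / 2)) \<le> m"
        using LIMSEQ_le_const[of _ "m + m * 0"] bound by fastforce
    qed
    have "norm (H (b + of_nat k * (m / 2))) = m" for k
    proof (induction k)
      case 0 then show ?case by (simp add: H_def m_def)
    next
      case (Suc k)
      have "b + of_nat (Suc k) * (m / 2) = (b + of_nat k * (m / 2)) + m / 2"
        by (simp add: field_simps)
      then show ?case using step[OF Suc] by (simp only:)
    qed
    \<comment> \<open>Five steps of length \<open>m / 2\<close> exceed the diameter \<open>2 * m\<close> of the sphere of radius \<open>m\<close>.\<close>
    from this[of 5] this[of 0] have "norm (H (b + 5 * (m / 2)) - H b) \<le> m + m"
      using norm_triangle_ineq4[of "H (b + 5 * (m / 2))" "H b"] by simp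
    moreover have "H (b + 5 * (m / 2)) - H b = of_real (5 * (m / 2))"
      by (simp add: H_def)
    ultimately show False using m by (simp only: norm_of_real)
  qed
  then show ?thesis by (auto simp: m_def)
qed

text \<open>
  Completing the square, a shift of every element by a real number squares to a real number \<open>d\<close>.
  If \<open>d \<ge> 0\<close> the element is real. A single instance of \<open>d < 0\<close> yields a square root \<open>j\<close> of \<open>-1\<close>,
  and then all others are expressed by it, since square roots in a field are unique up to sign.
\<close>
lemma real_normed_field_real_or_complex:
  "(\<forall>y::'k::real_normed_field. \<exists>a. y = of_real a) \<or>
    (\<exists>j::'k. j\<^sup>2 = -1 \<and> (\<forall>y. \<exists>a b. y = of_real a + of_real b * j))"
proof -
  have square: "\<exists>a d. (y + of_real a)\<^sup>2 = of_real d" for y :: 'k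
  proof -
    obtain a b where "y\<^sup>2 + of_real a * y + of_real b = 0"
      using real_normed_field_quadratic[of y] by blast
    then have "y\<^sup>2 + of_real a * y = - of_real b"
      using eq_neg_iff_add_eq_0 by blast
    then have "y\<^sup>2 + of_real a * y + (of_real (a / 2))\<^sup>2 = (of_real (a / 2))\<^sup>2 - of_real b"
      by simp
    moreover have "(y + of_real (a / 2))\<^sup>2 = y\<^sup>2 + of_real a * y + (of_real (a / 2))\<^sup>2"
      by (simp add: power2_sum)
    ultimately have "(y + of_real (a / 2))\<^sup>2 = of_real ((a / 2)\<^sup>2 - b)"
      by (simp only: of_real_diff of_real_power)
    then show ?thesis by blast
  qed
  have nonneg: "\<exists>a. y = of_real a" if "(y + of_real a)\<^sup>2 = of_real d" "d \<ge> 0" for y :: 'k and a d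
  proof -
    have "(y + of_real a)\<^sup>2 = (of_real (sqrt d))\<^sup>2"
      using that by (simp flip: of_real_power)
    then have "y + of_real a = of_real (sqrt d) \<or> y + of_real a = - of_real (sqrt d)"
      by (simp only: power2_eq_iff)
    then have "y = of_real (sqrt d - a) \<or> y = of_real (- sqrt d - a)"
      by (auto simp: algebra_simps eq_diff_eq)
    then show ?thesis by blast
  qed
  show ?thesis
  proof (cases "\<forall>y::'k. \<exists>a. y = of_real a")
    case True then show ?thesis by blast
  next
    case False
    then obtain x :: 'k where x: "\<nexists>a. x = of_real a" by blast
    obtain a d where ad: "(x + of_real a)\<^sup>2 = of_real d" using square by blast
    have d: "d < 0" using nonneg[OF ad] x by force
    define j where "j = (x + of_real a) / of_real (sqrt (- d))"
    have "j\<^sup>2 = of_real d / of_real ((sqrt (- d))\<^sup>2)"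
      by (simp add: j_def power_divide ad flip: of_real_power)
    then have j: "j\<^sup>2 = -1" using d by simp
    have "\<exists>a b. y = of_real a + of_real b * j" for y
    proof -
      obtain a d where ad: "(y + of_real a)\<^sup>2 = of_real d" using square by blast
      show ?thesis
      proof (cases "d \<ge> 0")
        case True
        then obtain r where "y = of_real r" using nonneg ad by blast
        then have "y = of_real r + of_real 0 * j" by simp
        then show ?thesis by blast
      next
        case False
        have "(of_real (sqrt (- d)) * j)\<^sup>2 = of_real ((sqrt (- d))\<^sup>2) * j\<^sup>2"
          by (simp add: power_mult_distrib)
        also have "\<dots> = of_real d" using False j by simp
        finally have "(y + of_real a)\<^sup>2 = (of_real (sqrt (- d)) * j)\<^sup>2" using ad by simp
        then have "y + of_real a = of_real (sqrt (- d)) * j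
            \<or> y + of_real a = - (of_real (sqrt (- d)) * j)"
          by (simp only: power2_eq_iff)
        then have "y = of_real (- a) + of_real (sqrt (- d)) * j
            \<or> y = of_real (- a) + of_real (- sqrt (- d)) * j"
          unfolding of_real_minus mult_minus_left by (metis add.commute add_diff_cancel_right' diff_conv_add_uminus)
        then show ?thesis by blast
      qed
    qed
    then show ?thesis using j by blast
  qed
qed

text \<open>
  In the complex case, the two real coordinates are bounded by the norm, because
  \<open>(a + b j) (a - b j) = a\<^sup>2 + b\<^sup>2\<close> and the second factor has norm at most \<open>\<bar>a\<bar> + \<bar>b\<bar>\<close>.
  So a Cauchy sequence has Cauchy coordinates.
\<close>
lemma real_normed_field_Cauchy_convergent:
  fixes \<sigma> :: "nat \<Rightarrow> 'k::real_normed_field"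
  assumes "Cauchy \<sigma>"
  shows "convergent \<sigma>"
proof -
  consider (real) "\<forall>y::'k. \<exists>a. y = of_real a"
    | (complex) j :: 'k where "j\<^sup>2 = -1" "\<forall>y. \<exists>a b. y = of_real a + of_real b * j"
    using real_normed_field_real_or_complex by blast
  then show ?thesis
  proof cases
    case real
    then have "\<forall>n. \<exists>r. \<sigma> n = of_real r" by blast
    then obtain r where r: "\<And>n. \<sigma> n = of_real (r n)" by (auto dest: choice)
    have "dist (r m) (r n) = dist (\<sigma> m) (\<sigma> n)" for m n
      by (simp add: r dist_norm flip: of_real_diff)
    then have "Cauchy r" using assms by (simp add: Cauchy_def)
    then obtain l where "r \<longlonglongrightarrow> l" using Cauchy_convergent convergent_def by blast
    then have "(\<lambda>n. of_real (r n) :: 'k) \<longlonglongrightarrow> of_real l" by (intro tendsto_intros)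
    then have "\<sigma> \<longlonglongrightarrow> of_real l" by (simp flip: r)
    then show ?thesis by (rule convergentI)
  next
    case (complex j)
    have "norm j ^ 2 = 1" using complex(1) by (simp flip: norm_power)
    then have nj: "norm j = 1" by (simp add: power2_eq_1_iff) (use norm_ge_zero[of j] in linarith)
    have lower: "norm (a, b) \<le> 2 * norm (of_real a + of_real b * j)" for a b :: real
    proof -
      let ?n = "norm (a, b)"
      have n2: "?n\<^sup>2 = a\<^sup>2 + b\<^sup>2" by (simp add: norm_Pair)
      have ab: "\<bar>a\<bar> \<le> ?n" "\<bar>b\<bar> \<le> ?n"
        using norm_fst_le[of a b] norm_snd_le[of b a] by auto
      have "(of_real a + of_real b * j) * (of_real a - of_real b * j) = of_real (a\<^sup>2) - of_real (b\<^sup>2) * j\<^sup>2"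
        by (simp add: algebra_simps power2_eq_square)
      also have "\<dots> = of_real (?n\<^sup>2)" by (simp only: complex(1) n2) simp
      finally have "norm (of_real a + of_real b * j) * norm (of_real a - of_real b * j) = ?n\<^sup>2"
        by (metis abs_power2 norm_mult norm_of_real)
      moreover have "norm (of_real a - of_real b * j) \<le> 2 * ?n"
        using norm_triangle_ineq4[of "of_real a" "of_real b * j"] ab by (simp add: norm_mult nj)
      ultimately have "?n\<^sup>2 \<le> norm (of_real a + of_real b * j) * (2 * ?n)"
        by (metis mult_left_mono norm_ge_zero)
      then have "?n * ?n \<le> (2 * norm (of_real a + of_real b * j)) * ?n"
        by (simp add: power2_eq_square mult_ac)
      then show ?thesis
        by (cases "?n = 0") (auto simp: mult_le_cancel_right)
    qed
    have "\<forall>n. \<exists>a b. \<sigma> n = of_real a + of_real b * j"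
      using complex(2) by blast
    then obtain a b where ab: "\<And>n. \<sigma> n = of_real (a n) + of_real (b n) * j"
      unfolding choice_iff by blast
    have "norm ((a m, b m) - (a n, b n)) \<le> 2 * norm (\<sigma> m - \<sigma> n)" for m n
      using lower[of "a m - a n" "b m - b n"] by (simp add: ab algebra_simps)
    then have le: "dist (a m, b m) (a n, b n) \<le> 2 * dist (\<sigma> m) (\<sigma> n)" for m n
      by (simp add: dist_norm)
    have "Cauchy (\<lambda>n. (a n, b n))"
    proof (rule metric_CauchyI)
      fix e :: real assume "e > 0"
      then obtain M where "\<forall>m\<ge>M. \<forall>n\<ge>M. dist (\<sigma> m) (\<sigma> n) < e / 2"
        using metric_CauchyD[OF assms, of "e / 2"] by auto
      then show "\<exists>M. \<forall>m\<ge>M. \<forall>n\<ge>M. dist (a m, b m) (a n, b n) < e"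
        using le by (smt (verit) field_sum_of_halves)
    qed
    then obtain l where l: "(\<lambda>n. (a n, b n)) \<longlonglongrightarrow> l"
      using Cauchy_convergent convergent_def by blast
    then have "(\<lambda>n. of_real (a n) + of_real (b n) * j) \<longlonglongrightarrow> of_real (fst l) + of_real (snd l) * j"
      using tendsto_fst[OF l] tendsto_snd[OF l] by (intro tendsto_intros) auto
    then have "\<sigma> \<longlonglongrightarrow> of_real (fst l) + of_real (snd l) * j" by (simp flip: ab)
    then show ?thesis by (rule convergentI)
  qed
qed

section \<open>Finite-dimensional spaces of sequences\<close>

definition vanishing_from :: "nat \<Rightarrow> (nat \<Rightarrow> 'k::zero) set"
  where "vanishing_from n = {v. \<forall>i\<ge>n. v i = 0}"

lemma vector_space_smul_seq: "vector_space (smul_seq :: 'k::real_normed_field \<Rightarrow> _)"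
  by unfold_locales (auto simp: smul_seq_def fun_eq_iff algebra_simps)

lemma subspace_vanishing_from:
  "module.subspace smul_seq (vanishing_from n :: (nat \<Rightarrow> 'k::real_normed_field) set)"
proof -
  interpret vector_space "smul_seq :: 'k \<Rightarrow> _" by (rule vector_space_smul_seq)
  show ?thesis
    by (rule subspaceI) (auto simp: vanishing_from_def smul_seq_def)
qed

lemma finite_span_vanishing_from:
  "\<exists>B. finite B \<and> module.span smul_seq B = (vanishing_from n :: (nat \<Rightarrow> 'k::real_normed_field) set)"
proof -
  interpret vector_space "smul_seq :: 'k \<Rightarrow> _" by (rule vector_space_smul_seq)
  define e :: "nat \<Rightarrow> nat \<Rightarrow> 'k" where "e i = (\<lambda>j. if j = i then 1 else 0)" for i
  have "span (e ` {..<n}) = vanishing_from n"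
  proof
    show "span (e ` {..<n}) \<subseteq> vanishing_from n"
      by (rule span_minimal[OF _ subspace_vanishing_from]) (auto simp: e_def vanishing_from_def)
    show "vanishing_from n \<subseteq> span (e ` {..<n})"
    proof
      fix v :: "nat \<Rightarrow> 'k" assume v: "v \<in> vanishing_from n"
      have sum_app: "(\<Sum>i\<in>I. smul_seq (v i) (e i)) k = (\<Sum>i\<in>I. v i * e i k)" if "finite I" for I k
        using that by (induction I rule: finite_induct) (auto simp: smul_seq_def)
      have "v = (\<Sum>i<n. smul_seq (v i) (e i))"
      proof
        fix k
        have "(\<Sum>i<n. v i * e i k) = (\<Sum>i<n. if i = k then v k else 0)"
          by (intro sum.cong) (auto simp: e_def)
        also have "\<dots> = v k"
          using v by (auto simp: vanishing_from_def)
        finally show "v k = (\<Sum>i<n. smul_seq (v i) (e i)) k" by (simp add: sum_app)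
      qed
      also have "\<dots> \<in> span (e ` {..<n})"
        by (intro span_sum span_scale span_base) auto
      finally show "v \<in> span (e ` {..<n})" .
    qed
  qed
  then show ?thesis by blast
qed

text \<open>
  When all semi-norms coincide with one norm, the topology is that of the metric of this norm.
  The lower bound makes the coordinates of a Cauchy sequence Cauchy, so that they converge in the
  complete scalar field; the upper bound turns convergence of the coordinates into
  convergence in norm.
\<close>
lemma finite_dim_frechet_vanishing_from:
  fixes N :: "(nat \<Rightarrow> 'k::real_normed_field) \<Rightarrow> real"
  assumes N: "is_seminorm_on smul_seq (vanishing_from n) N"
    and lower: "\<And>v i. v \<in> vanishing_from n \<Longrightarrow> i < n \<Longrightarrow> norm (v i) \<le> C * N v"
    and upper: "\<And>v. v \<in> vanishing_from n \<Longrightarrow> N v \<le> (\<Sum>i<n. norm (v i))"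
  shows "finite_dim_frechet_space smul_seq \<lparr>points = vanishing_from n, snorm = \<lambda>_. N\<rparr>"
proof -
  interpret vector_space "smul_seq :: 'k \<Rightarrow> _" by (rule vector_space_smul_seq)
  let ?V = "vanishing_from n :: (nat \<Rightarrow> 'k) set"
  let ?F = "\<lparr>points = ?V, snorm = \<lambda>_::nat. N\<rparr>"
  have diff: "u - v \<in> ?V" if "u \<in> ?V" "v \<in> ?V" for u v
    using that by (auto simp: vanishing_from_def)
  have scale: "N (smul_seq c v) = norm c * N v" if "v \<in> ?V" for c v
    using N that by (auto simp: is_seminorm_on_def)
  have tri: "N (u + v) \<le> N u + N v" if "u \<in> ?V" "v \<in> ?V" for u v
    using N that by (auto simp: is_seminorm_on_def)
  have nonneg: "0 \<le> N v" if "v \<in> ?V" for v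
    using N that by (auto simp: is_seminorm_on_def)
  have comm: "N (u - v) = N (v - u)" if "u \<in> ?V" "v \<in> ?V" for u v
  proof -
    have "u - v = smul_seq (- 1) (v - u)" by (auto simp: smul_seq_def)
    then show ?thesis using scale[OF diff[OF that(2,1)], of "- 1"] by simp
  qed
  have zero: "v = 0" if "v \<in> ?V" "N v = 0" for v
  proof
    fix i show "v i = 0 i"
      using that lower[of v i] by (cases "i < n") (auto simp: vanishing_from_def)
  qed
  have "N (smul_seq 0 0) = 0" using scale[of 0 0] by (simp add: vanishing_from_def)
  then have N0: "N 0 = 0" by (simp add: smul_seq_def zero_fun_def)
  \<comment> \<open>The value off the space keeps \<open>d\<close> nonnegative and symmetric for arbitrary arguments, which a
    metric on a carrier set has to be.\<close>
  define d where "d u v = (if u \<in> ?V \<and> v \<in> ?V then N (u - v) else 0)" for u v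
  interpret M: Metric_space ?V d
  proof
    show "0 \<le> d u v" for u v using nonneg diff by (simp add: d_def)
    show "d u v = d v u" for u v using comm by (simp add: d_def)
    show "d u v = 0 \<longleftrightarrow> u = v" if "u \<in> ?V" "v \<in> ?V" for u v
      using zero[OF diff[OF that]] that N0 by (auto simp: d_def)
    show "d u w \<le> d u v + d v w" if "u \<in> ?V" "v \<in> ?V" "w \<in> ?V" for u v w
      using tri[OF diff[OF that(1,2)] diff[OF that(2,3)]] that by (simp add: d_def)
  qed
  have ball: "{y \<in> ?V. N (y - x) < r} = M.mball x r" if "x \<in> ?V" for x r
    using that comm by (auto simp: M.mball_def d_def)
  have top: "snorm_topology ?F = M.mtopology"
  proof -
    let ?B = "{{y \<in> points ?F. snorm ?F i (y - x) < r} | i x r. x \<in> points ?F \<and> 0 < r}"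
    have B: "?B = {M.mball x r | x r. x \<in> ?V \<and> 0 < r}"
    proof (intro equalityI subsetI)
      fix S assume "S \<in> ?B"
      then obtain x r where "S = {y \<in> ?V. N (y - x) < r}" "x \<in> ?V" "0 < r" by auto
      then show "S \<in> {M.mball x r | x r. x \<in> ?V \<and> 0 < r}" using ball by blast
    next
      fix S assume "S \<in> {M.mball x r | x r. x \<in> ?V \<and> 0 < r}"
      then obtain x r where "S = {y \<in> ?V. N (y - x) < r}" "x \<in> ?V" "0 < r"
        using ball by auto
      then show "S \<in> ?B" by auto
    qed
    have "openin M.mtopology U" if "generate_topology_on ?B U" for U
      using that
    proof induction
      case (Basis s) then show ?case unfolding B by auto
    qed auto
    moreover have "generate_topology_on ?B U" if U: "openin M.mtopology U" for U
    proof -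
      have "U = \<Union>{b \<in> ?B. b \<subseteq> U}"
      proof (intro equalityI subsetI)
        fix x assume "x \<in> U"
        with U obtain r where "r > 0" "M.mball x r \<subseteq> U" "x \<in> ?V"
          by (metis M.openin_mtopology subsetD)
        then show "x \<in> \<Union>{b \<in> ?B. b \<subseteq> U}" unfolding B by auto
      qed blast
      moreover have "generate_topology_on ?B (\<Union>{b \<in> ?B. b \<subseteq> U})"
        by (rule generate_topology_on.UN) (auto intro: generate_topology_on.Basis)
      ultimately show ?thesis by simp
    qed
    ultimately show ?thesis
      unfolding snorm_topology_def topology_eq openin_topology_generated_by_iff by blast
  qed
  have "\<exists>l. limitin (snorm_topology ?F) \<sigma> l sequentially" if "snorm_Cauchy ?F \<sigma>" for \<sigma>
  proof -
    have mem: "\<sigma> m \<in> ?V" for m using that by (auto simp: snorm_Cauchy_def)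
    have cau: "\<exists>M. \<forall>m\<ge>M. \<forall>k\<ge>M. N (\<sigma> m - \<sigma> k) < e" if "e > 0" for e
      using \<open>snorm_Cauchy ?F \<sigma>\<close> that by (simp add: snorm_Cauchy_def)
    have "\<exists>l. (\<lambda>m. \<sigma> m i) \<longlonglongrightarrow> l" if i: "i < n" for i
    proof -
      have "Cauchy (\<lambda>m. \<sigma> m i)"
      proof (rule CauchyI)
        fix e :: real assume e: "e > 0"
        then obtain M where M: "\<And>m k. m \<ge> M \<Longrightarrow> k \<ge> M \<Longrightarrow> N (\<sigma> m - \<sigma> k) < e / (\<bar>C\<bar> + 1)"
          using cau[of "e / (\<bar>C\<bar> + 1)"] by (auto simp: divide_pos_pos)
        have "norm (\<sigma> m i - \<sigma> k i) < e" if "m \<ge> M" "k \<ge> M" for m k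
        proof -
          have "norm (\<sigma> m i - \<sigma> k i) \<le> C * N (\<sigma> m - \<sigma> k)"
            using lower[OF diff[OF mem[of m] mem[of k]] i] by simp
          also have "\<dots> \<le> (\<bar>C\<bar> + 1) * N (\<sigma> m - \<sigma> k)"
            using nonneg[OF diff[OF mem[of m] mem[of k]]] by (intro mult_right_mono) auto
          also have "\<dots> < e" using M[OF that] by (simp add: field_simps add_pos_nonneg)
          finally show ?thesis .
        qed
        then show "\<exists>M. \<forall>m\<ge>M. \<forall>k\<ge>M. norm (\<sigma> m i - \<sigma> k i) < e" by blast
      qed
      then show ?thesis
        using real_normed_field_Cauchy_convergent by (auto simp: convergent_def)
    qed
    then obtain L where L: "\<And>i. i < n \<Longrightarrow> (\<lambda>m. \<sigma> m i) \<longlonglongrightarrow> L i" by metis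
    define l where "l = (\<lambda>i. if i < n then L i else 0)"
    have l: "l \<in> ?V" by (simp add: l_def vanishing_from_def)
    have "(\<lambda>m. \<Sum>i<n. norm (\<sigma> m i - l i)) \<longlonglongrightarrow> (\<Sum>i<n. norm (l i - l i))"
      by (intro tendsto_intros) (auto simp: l_def L)
    then have lim: "(\<lambda>m. \<Sum>i<n. norm ((\<sigma> m - l) i)) \<longlonglongrightarrow> 0" by simp
    have "(\<lambda>m. d (\<sigma> m) l) \<longlonglongrightarrow> 0"
    proof (rule tendsto_sandwich[OF _ _ tendsto_const lim])
      show "\<forall>\<^sub>F m in sequentially. 0 \<le> d (\<sigma> m) l" by simp
      show "\<forall>\<^sub>F m in sequentially. d (\<sigma> m) l \<le> (\<Sum>i<n. norm ((\<sigma> m - l) i))"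
        using upper[OF diff[OF mem l]] mem l by (simp add: d_def)
    qed
    then have "limitin M.mtopology \<sigma> l sequentially"
      unfolding M.limit_metric_sequentially using l mem by (auto simp: LIMSEQ_iff)
    then show ?thesis unfolding top by blast
  qed
  moreover have "metrizable_space (snorm_topology ?F)"
    unfolding top by (rule M.metrizable_space_mtopology)
  ultimately show ?thesis
    unfolding finite_dim_frechet_space_def frechet_space_def
    by (simp add: vector_space_smul_seq subspace_vanishing_from N finite_span_vanishing_from)
qed

section \<open>A plane and its extensions by one dimension\<close>

definition euclid2 :: "(nat \<Rightarrow> 'k::real_normed_field) \<Rightarrow> real"
  where "euclid2 v = norm (v 0, v 1)"

definition rot_form :: "real \<Rightarrow> (nat \<Rightarrow> 'k::real_normed_field) \<Rightarrow> 'k"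
  where "rot_form t v = of_real (cos t) * v 0 + of_real (sin t) * v 1"

text \<open>
  The maximum is governed by the second term at vectors of the plane parallel to
  \<open>(cos t, sin t)\<close>, where both terms agree, and by the first term near all others. So adding the
  third unit vector to a long vector of the plane increases its norm if it is parallel to
  \<open>(cos t, sin t)\<close>, and leaves it unchanged otherwise.
\<close>
definition tilted :: "real \<Rightarrow> (nat \<Rightarrow> 'k::real_normed_field) \<Rightarrow> real"
  where "tilted t v = max (euclid2 v) (norm (rot_form t v) + norm (v 2))"

lemma euclid2_scale: "euclid2 (smul_seq c v) = norm c * euclid2 v"
proof -
  have "norm (c * a, c * b) = norm c * norm (a, b)" for a b :: 'a
    by (simp add: norm_Pair norm_mult power_mult_distrib real_sqrt_mult flip: distrib_left)
  then show ?thesis by (simp add: euclid2_def smul_seq_def)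
qed

lemma euclid2_triangle: "euclid2 (u + v) \<le> euclid2 u + euclid2 v"
  unfolding euclid2_def using norm_triangle_ineq[of "(u 0, u 1)" "(v 0, v 1)"] by simp

lemma rot_form_le_euclid2: "norm (rot_form t v) \<le> euclid2 v"
proof -
  have "norm (rot_form t v) \<le> \<bar>cos t\<bar> * norm (v 0) + \<bar>sin t\<bar> * norm (v 1)"
    unfolding rot_form_def by (rule norm_triangle_le) (simp add: norm_mult)
  also have "\<dots> = (\<bar>cos t\<bar>, \<bar>sin t\<bar>) \<bullet> (norm (v 0), norm (v 1))" by simp
  also have "\<dots> \<le> norm (\<bar>cos t\<bar>, \<bar>sin t\<bar>) * norm (norm (v 0), norm (v 1))"
    by (rule norm_cauchy_schwarz)
  also have "\<dots> = euclid2 v" by (simp add: norm_Pair euclid2_def)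
  finally show ?thesis .
qed

lemma is_seminorm_on_euclid2: "is_seminorm_on smul_seq V euclid2"
  unfolding is_seminorm_on_def
  using euclid2_scale euclid2_triangle by (auto simp: euclid2_def)

lemma is_seminorm_on_tilted: "is_seminorm_on smul_seq V (tilted t)"
  unfolding is_seminorm_on_def
proof (intro conjI ballI allI)
  fix u v :: "nat \<Rightarrow> 'a" and c :: 'a
  show "0 \<le> tilted t v" by (simp add: tilted_def euclid2_def max.coboundedI1)
  have "rot_form t (smul_seq c v) = c * rot_form t v"
    by (simp add: rot_form_def smul_seq_def algebra_simps)
  moreover have "norm (smul_seq c v 2) = norm c * norm (v 2)"
    by (simp add: smul_seq_def norm_mult)
  ultimately show "tilted t (smul_seq c v) = norm c * tilted t v"
    by (simp add: tilted_def euclid2_scale norm_mult max_mult_distrib_left distrib_left)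
  have "rot_form t (u + v) = rot_form t u + rot_form t v"
    by (simp add: rot_form_def algebra_simps)
  then have "norm (rot_form t (u + v)) + norm ((u + v) 2)
      \<le> (norm (rot_form t u) + norm (u 2)) + (norm (rot_form t v) + norm (v 2))"
    using norm_triangle_ineq[of "rot_form t u" "rot_form t v"] norm_triangle_ineq[of "u 2" "v 2"]
    by simp
  then show "tilted t (u + v) \<le> tilted t u + tilted t v"
    using euclid2_triangle[of u v] unfolding tilted_def by linarith
qed

lemma tilted_extends_euclid2: "v \<in> vanishing_from 2 \<Longrightarrow> tilted t v = euclid2 v"
  by (simp add: tilted_def vanishing_from_def rot_form_le_euclid2 max_absorb1)

lemma euclid2_bounds:
  "norm (v 0) \<le> euclid2 v" "norm (v 1) \<le> euclid2 v" "euclid2 v \<le> norm (v 0) + norm (v 1)"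
  unfolding euclid2_def by (auto intro: norm_fst_le norm_snd_le norm_Pair_le)

lemma finite_dim_frechet_euclid2:
  "finite_dim_frechet_space (smul_seq :: 'k::real_normed_field \<Rightarrow> _)
    \<lparr>points = vanishing_from 2, snorm = \<lambda>_. euclid2\<rparr>"
proof (rule finite_dim_frechet_vanishing_from[where C = 1])
  fix v :: "nat \<Rightarrow> 'k" and i :: nat
  show "i < 2 \<Longrightarrow> norm (v i) \<le> 1 * euclid2 v"
    using euclid2_bounds[of v] by (auto simp: less_2_cases_iff)
  show "euclid2 v \<le> (\<Sum>i<2. norm (v i))"
    using euclid2_bounds(3)[of v] by (simp add: numeral_2_eq_2)
qed (rule is_seminorm_on_euclid2)

lemma finite_dim_frechet_tilted:
  "finite_dim_frechet_space (smul_seq :: 'k::real_normed_field \<Rightarrow> _)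
    \<lparr>points = vanishing_from 3, snorm = \<lambda>_. tilted t\<rparr>"
proof (rule finite_dim_frechet_vanishing_from[where C = 1])
  fix v :: "nat \<Rightarrow> 'k" and i :: nat
  assume "i < 3"
  then have "i = 0 \<or> i = 1 \<or> i = 2" by auto
  moreover have "euclid2 v \<le> tilted t v" "norm (v 2) \<le> tilted t v"
    by (auto simp: tilted_def intro: max.coboundedI2)
  ultimately show "norm (v i) \<le> 1 * tilted t v"
    using euclid2_bounds[of v] by auto
next
  fix v :: "nat \<Rightarrow> 'k"
  have "tilted t v \<le> euclid2 v + norm (v 2)"
    using rot_form_le_euclid2[of t v] by (simp add: tilted_def)
  then show "tilted t v \<le> (\<Sum>i<3. norm (v i))"
    using euclid2_bounds(3)[of v] by (simp add: numeral_3_eq_3 numeral_2_eq_2)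
qed (rule is_seminorm_on_tilted)

lemma finite_dim_frechet_zero:
  "finite_dim_frechet_space (smul_seq :: 'k::real_normed_field \<Rightarrow> _)
    \<lparr>points = vanishing_from 0, snorm = \<lambda>_ _. 0\<rparr>"
  by (rule finite_dim_frechet_vanishing_from) (auto simp: is_seminorm_on_def)

definition direction :: "real \<Rightarrow> nat \<Rightarrow> 'k::real_normed_field"
  where "direction t = (\<lambda>i. if i = 0 then of_real (cos t) else if i = 1 then of_real (sin t) else 0)"

definition apex :: "nat \<Rightarrow> 'k::real_normed_field"
  where "apex = (\<lambda>i. if i = 2 then 1 else 0)"

text \<open>
  For \<open>s = t\<close> the value is \<open>r + 1\<close>. If \<open>c < 1\<close> it drops to \<open>r\<close> once \<open>r (1 - c) \<ge> 1\<close>. This gap is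
  what forces the images of \<open>apex\<close> apart.
\<close>
lemma tilted_direction_apex:
  fixes r s t :: real
  defines "c \<equiv> \<bar>cos (s - t)\<bar>"
  assumes "r \<ge> 0"
  shows "tilted s (smul_seq (of_real r) (direction t) + apex :: nat \<Rightarrow> 'k::real_normed_field)
    = max r (r * c + 1)"
proof -
  let ?v = "smul_seq (of_real r) (direction t) + apex :: nat \<Rightarrow> 'k"
  have v: "?v 0 = of_real (r * cos t)" "?v 1 = of_real (r * sin t)" "?v 2 = 1"
    by (simp_all add: smul_seq_def direction_def apex_def)
  have "(r * cos t)\<^sup>2 + (r * sin t)\<^sup>2 = r\<^sup>2"
    by (simp add: power_mult_distrib flip: distrib_left)
  then have "euclid2 ?v = r"
    using assms by (simp only: euclid2_def v norm_Pair norm_of_real power2_abs) simp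
  moreover have "rot_form s ?v = of_real (r * cos (s - t))"
    unfolding rot_form_def v by (simp add: cos_diff algebra_simps)
  ultimately show ?thesis
    using assms by (simp only: tilted_def v norm_of_real norm_one abs_mult abs_of_nonneg c_def)
qed

lemma abs_cos_less_1:
  fixes d :: real
  assumes "d \<noteq> 0" "\<bar>d\<bar> \<le> 1"
  shows "\<bar>cos d\<bar> < 1"
proof -
  have "sin \<bar>d\<bar> > 0" using assms pi_gt3 by (intro sin_gt_zero) auto
  then have "sin d \<noteq> 0" by (auto simp: abs_if split: if_splits)
  then have "(cos d)\<^sup>2 < 1" by (simp add: cos_squared_eq)
  then show ?thesis by (simp add: abs_square_less_1)
qed

section \<open>Separated families in separable spaces\<close>

text \<open>
  Balls of radius \<open>1/2\<close> around the points of the family are open and pairwise disjoint, so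
  a choice of a point of a countable dense set in each of them is injective.
\<close>
lemma separated_family_countable:
  fixes y :: "'i \<Rightarrow> 'a::ab_group_add"
  assumes sep: "separable_space (snorm_topology F)"
    and closed: "\<And>u v. u \<in> points F \<Longrightarrow> v \<in> points F \<Longrightarrow> u - v \<in> points F"
    and p: "snorm F i 0 = 0"
      "\<And>u. u \<in> points F \<Longrightarrow> snorm F i (- u) = snorm F i u"
      "\<And>u v. u \<in> points F \<Longrightarrow> v \<in> points F \<Longrightarrow> snorm F i (u + v) \<le> snorm F i u + snorm F i v"
    and y: "\<And>t. t \<in> T \<Longrightarrow> y t \<in> points F"
    and far: "\<And>s t. s \<in> T \<Longrightarrow> t \<in> T \<Longrightarrow> s \<noteq> t \<Longrightarrow> 1 \<le> snorm F i (y s - y t)"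
  shows "countable T"
proof -
  obtain C where C: "countable C" "snorm_topology F closure_of C = topspace (snorm_topology F)"
    using sep by (auto simp: separable_space_def)
  have "\<exists>c\<in>C. c \<in> points F \<and> snorm F i (c - y t) < 1 / 2" if t: "t \<in> T" for t
  proof -
    let ?U = "{u \<in> points F. snorm F i (u - y t) < 1 / 2}"
    have U: "openin (snorm_topology F) ?U"
      unfolding snorm_topology_def
    proof (intro topology_generated_by_Basis CollectI exI conjI)
      show "?U = {u \<in> points F. snorm F i (u - y t) < 1 / 2}" ..
      show "y t \<in> points F" by (rule y[OF t])
    qed simp
    moreover have "y t \<in> ?U" using y[OF t] p(1) by simp
    ultimately have "y t \<in> snorm_topology F closure_of C"
      using C(2) openin_subset by blast
    then have "\<And>S. y t \<in> S \<Longrightarrow> openin (snorm_topology F) S \<Longrightarrow> \<exists>u. u \<in> C \<and> u \<in> S"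
      by (simp add: in_closure_of)
    from this[OF \<open>y t \<in> ?U\<close> U] obtain u where "u \<in> C" "u \<in> ?U" by blast
    then show ?thesis by blast
  qed
  then obtain c where c: "\<And>t. t \<in> T \<Longrightarrow> c t \<in> C \<and> c t \<in> points F \<and> snorm F i (c t - y t) < 1 / 2"
    by metis
  have "inj_on c T"
  proof (rule inj_onI, rule ccontr)
    fix s t assume st: "s \<in> T" "t \<in> T" "c s = c t" "s \<noteq> t"
    have mem: "c s - y s \<in> points F" "c s - y t \<in> points F"
      using c y st closed by metis+
    have "0 - (c s - y s) \<in> points F"
      using closed[OF closed[OF mem(1) mem(1)] mem(1)] by simp
    then have "snorm F i (- (c s - y s) + (c s - y t)) \<le> snorm F i (c s - y s) + snorm F i (c s - y t)"
      using p(2)[OF mem(1)] p(3)[OF _ mem(2), of "- (c s - y s)"] by simp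
    also have "\<dots> < 1 / 2 + 1 / 2"
      using c[OF st(1)] c[OF st(2)] unfolding st(3) by (intro add_strict_mono) blast+
    finally have "snorm F i (y s - y t) < 1" by simp
    then show False using far[OF st(1,2,4)] by simp
  qed
  moreover have "c ` T \<subseteq> C" using c by blast
  ultimately show ?thesis
    using C(1) countable_subset countable_image_inj_on by metis
qed

theorem proposition5p2:
  fixes smul :: "'k::real_normed_field \<Rightarrow> 'a::ab_group_add \<Rightarrow> 'a"
  assumes "vector_space smul"
  shows "\<not> (\<exists>F :: 'a seminormed.
    frechet_space smul F \<and> separable_space (snorm_topology F) \<and> universal_disposition smul F)"
proof
  assume "\<exists>F :: 'a seminormed.
    frechet_space smul F \<and> separable_space (snorm_topology F) \<and> universal_disposition smul F"
  then obtain F :: "'a seminormed" where frechet: "frechet_space smul F"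
    and sep: "separable_space (snorm_topology F)" and univ: "universal_disposition smul F" by blast
  interpret vector_space smul by fact
  have sub: "subspace (points F)" using frechet by (simp add: frechet_space_def)
  have semi: "is_seminorm_on smul (points F) (snorm F i)" for i
    using frechet by (simp add: frechet_space_def)
  have scale: "snorm F i (smul c u) = norm c * snorm F i u" if "u \<in> points F" for i c u
    using semi[of i] that by (simp add: is_seminorm_on_def)
  have snorm0: "snorm F i 0 = 0" for i
    using scale[of 0 i 0] sub by (simp add: subspace_0)
  have snorm_minus: "snorm F i (- u) = snorm F i u" if "u \<in> points F" for i u
    using scale[OF that, of i "- 1"] by simp
  have snorm_add: "snorm F i (u + v) \<le> snorm F i u + snorm F i v"
    if "u \<in> points F" "v \<in> points F" for i u v
    using semi[of i] that by (simp add: is_seminorm_on_def)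
  let ?O = "\<lparr>points = vanishing_from 0 :: (nat \<Rightarrow> 'k) set, snorm = \<lambda>_ _. 0\<rparr>"
  let ?X = "\<lparr>points = vanishing_from 2 :: (nat \<Rightarrow> 'k) set, snorm = \<lambda>_. euclid2\<rparr>"
  let ?Y = "\<lambda>t. \<lparr>points = vanishing_from 3 :: (nat \<Rightarrow> 'k) set, snorm = \<lambda>_. tilted t\<rparr>"
  have van0: "vanishing_from 0 = {0 :: nat \<Rightarrow> 'k}" by (auto simp: vanishing_from_def)
  have "frechet_subspace ?O ?X"
    by (auto simp: frechet_subspace_def van0 vanishing_from_def euclid2_def zero_prod_def[symmetric])
  moreover have "isometric_embedding smul_seq smul ?O F (\<lambda>_. 0)"
    using sub snorm0 by (simp add: isometric_embedding_def van0 subspace_0)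
  ultimately obtain g where g: "isometric_embedding smul_seq smul ?X F g"
    using univ finite_dim_frechet_zero finite_dim_frechet_euclid2
    unfolding universal_disposition_def by blast
  have "\<exists>f. isometric_embedding smul_seq smul (?Y t) F f \<and> (\<forall>x\<in>vanishing_from 2. f x = g x)" for t
  proof -
    have "frechet_subspace ?X (?Y t)"
      by (simp add: frechet_subspace_def tilted_extends_euclid2) (simp add: vanishing_from_def subset_eq)
    then show ?thesis
      using univ finite_dim_frechet_euclid2 finite_dim_frechet_tilted g
      unfolding universal_disposition_def by fastforce
  qed
  then obtain f where f: "\<And>t. isometric_embedding smul_seq smul (?Y t) F (f t)"
    and fg: "\<And>t x. x \<in> vanishing_from 2 \<Longrightarrow> f t x = g x" by metis
  have f_mem: "f t v \<in> points F" and f_norm: "snorm F 0 (f t v) = tilted t v"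
    if "v \<in> vanishing_from 3" for t v
    using f[of t] that by (auto simp: isometric_embedding_def)
  have f_add: "f t (u + v) = f t u + f t v"
    if "u \<in> vanishing_from 3" "v \<in> vanishing_from 3" for t u v
    using f[of t] that by (auto simp: isometric_embedding_def)
  have apex: "(apex :: nat \<Rightarrow> 'k) \<in> vanishing_from 3" by (auto simp: apex_def vanishing_from_def)
  have far: "1 \<le> snorm F 0 (f s apex - f t apex)"
    if st: "s \<in> {0..1}" "t \<in> {0..1}" "s \<noteq> t" for s t
  proof -
    define c where "c = \<bar>cos (t - s)\<bar>"
    have c: "c < 1" unfolding c_def using st by (intro abs_cos_less_1) auto
    \<comment> \<open>The least \<open>r\<close> for which the norm with parameter \<open>t\<close> does not notice \<open>apex\<close>, that is
      \<open>r * c + 1 \<le> r\<close>.\<close>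
    define r where "r = 1 / (1 - c)"
    have r: "r \<ge> 0" "r * c + 1 = r" using c by (auto simp: r_def field_simps)
    define x :: "nat \<Rightarrow> 'k" where "x = smul_seq (of_real r) (direction s)"
    have x2: "x \<in> vanishing_from 2" and x3: "x \<in> vanishing_from 3"
      by (auto simp: x_def smul_seq_def direction_def vanishing_from_def)
    have xa: "x + apex \<in> vanishing_from 3" using x3 apex by (auto simp: vanishing_from_def)
    have norms: "tilted s (x + apex) = r + 1" "tilted t (x + apex) = r"
      using tilted_direction_apex[OF r(1), where 'k = 'k, of s s]
        tilted_direction_apex[OF r(1), where 'k = 'k, of t s] r
      by (simp_all add: x_def c_def)
    \<comment> \<open>Both extensions agree at \<open>x\<close>, which lies in the plane.\<close>
    have "f s (x + apex) = f t (x + apex) + (f s apex - f t apex)"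
      by (simp add: f_add[OF x3 apex] fg[OF x2])
    then have "r + 1 \<le> r + snorm F 0 (f s apex - f t apex)"
      using snorm_add[OF f_mem[OF xa, of t] subspace_diff[OF sub f_mem[OF apex] f_mem[OF apex]], of 0 s t]
        f_norm[OF xa] norms by metis
    then show ?thesis by simp
  qed
  have "countable {0..1::real}"
  proof (rule separated_family_countable[OF sep, where i = 0 and y = "\<lambda>t. f t apex"])
    show "u - v \<in> points F" if "u \<in> points F" "v \<in> points F" for u v
      using subspace_diff[OF sub that] .
    show "f t apex \<in> points F" for t by (rule f_mem[OF apex])
  qed (fact snorm0 snorm_minus snorm_add far)+
  moreover have "uncountable {0..1::real}"
    by (rule uncountable_closed_interval[THEN iffD2]) simp
  ultimately show False by simp
qed

end
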